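(* Let $T>0$, $\varepsilon>0$ and $c>0$. For each integer $N\ge 2$ let $\{\phi^{i}_t=\phi^{i,(N)}_t : i=0,\dots,N-1,\ 0\le t\le T\}$ be the solution of the finite periodic Riccati system of size $N$ (see context), and let $\{\varphi^{i}_t : i\in\mathbb N_0,\ 0\le t\le T\}$ be the solution of the infinite Riccati system (see context). Then for every fixed $j\in\mathbb N_0$ and $t\in[0,T]$, $$\lim_{N\to\infty}\phi^{j,(N)}_t=\varphi^{j}_t .$$
   Context: $\mathbb N_0=\{0,1,2,\dots\}$. Superscripts on $\phi,\varphi,\varepsilon$ are indices, not powers; a dot denotes $\frac{d}{dt}$. Put $\varepsilon^0:=\varepsilon$, $\varepsilon^1:=-\varepsilon$, $\varepsilon^i:=0$ for $i\ge 2$. Infinite Riccati system: real-valued functions $\varphi^i_t$, $i\in\mathbb N_0$, $0\le t\le T$, with $$\dot\varphi^i_t=\sum_{j=0}^{i}\varphi^j_t\,\varphi^{i-j}_t-\varepsilon^i,\qquad \varphi^0_T=c,\quad \varphi^1_T=-c,\quad \varphi^i_T=0\ (i\ge 2).$$ It has a unique solution on $[0,T]$. Finite periodic Riccati system of size $N\ge 2$: real-valued functions $\phi^i_t$, $i=0,\dots,N-1$, $0\le t\le T$, extended to all $i\in\mathbb Z$ by periodicity $\phi^{i+N}_t=\phi^i_t$, with $$\dot\phi^i_t=\sum_{j=0}^{N-1}\phi^j_t\,\phi^{N+i-j}_t-\varepsilon^i,\qquad \phi^0_T=c,\quad \phi^1_T=-c,\quad \phi^i_T=0\ (2\le i\le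 N-1).$$ It has a unique solution on $[0,T]$, which depends on $N$; this is indicated by writing $\phi^{i,(N)}_t$. The limit is taken over $N>j$. *)

theory Defs
  imports Complex_Main
begin

text \<open>The data \<open>x, -x, 0, 0, \<dots>\<close>: with \<open>x = \<epsilon>\<close> it is the inhomogeneity
  \<open>\<epsilon>\<^sup>i\<close> (an index, not a power), with \<open>x = c\<close> the terminal condition.\<close>

definition riccati_data :: "real \<Rightarrow> nat \<Rightarrow> real" where
  "riccati_data x i = (if i = 0 then x else if i = 1 then - x else 0)"

text \<open>Derivatives are taken within \<open>{0..T}\<close>, hence one-sided at the endpoints;
  values of the functions outside \<open>{0..T}\<close> play no role.\<close>

definition infinite_riccati_solution ::
    "real \<Rightarrow> real \<Rightarrow> real \<Rightarrow> (nat \<Rightarrow> real \<Rightarrow> real) \<Rightarrow> bool" where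
  "infinite_riccati_solution T \<epsilon> c \<phi> \<longleftrightarrow>
     (\<forall>i. \<forall>t\<in>{0..T}.
        (\<phi> i has_real_derivative
          (\<Sum>j=0..i. \<phi> j t * \<phi> (i - j) t) - riccati_data \<epsilon> i) (at t within {0..T})) \<and>
     (\<forall>i. \<phi> i T = riccati_data c i)"

text \<open>The functions are indexed by all integers, as the \<open>N\<close>-periodic extension of
  the \<open>N\<close> functions with indices \<open>0, \<dots>, N - 1\<close>; the equations are imposed for these
  indices only.\<close>

definition periodic_riccati_solution ::
    "nat \<Rightarrow> real \<Rightarrow> real \<Rightarrow> real \<Rightarrow> (int \<Rightarrow> real \<Rightarrow> real) \<Rightarrow> bool" where
  "periodic_riccati_solution N T \<epsilon> c \<phi> \<longleftrightarrow>
     (\<forall>i. \<forall>t\<in>{0..T}. \<phi> (i + int N) t = \<phi> i t) \<and>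
     (\<forall>i<N. \<forall>t\<in>{0..T}.
        (\<phi> (int i) has_real_derivative
          (\<Sum>j=0..N-1. \<phi> (int j) t * \<phi> (int N + int i - int j) t) - riccati_data \<epsilon> i)
          (at t within {0..T})) \<and>
     (\<forall>i<N. \<phi> (int i) T = riccati_data c i)"

end

theory Submission
  imports Defs "HOL-Analysis.Analysis"
begin

text \<open>The infinite solution satisfies \<open>\<psi>\<^sup>0 \<ge> 0\<close>, \<open>\<psi>\<^sup>i \<le> 0\<close> for \<open>i \<ge> 1\<close>, and all its partial
  sums are nonnegative: each claim follows inductively from a linear differential inequality,
  integrated backwards from \<open>T\<close>. Hence \<open>(\<psi>\<^sup>i)\<close> lies in \<open>\<ell>\<^sup>1\<close>, with norm at most \<open>2 \<psi>\<^sup>0\<close>.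
  The truncation of \<open>\<psi>\<close> to \<open>i < N\<close> solves the periodic system up to a residual, whose
  \<open>\<ell>\<^sup>1\<close>-norm \<open>(\<Sum>i<N. \<psi>\<^sup>i)\<^sup>2 - (\<Sum>i<N. \<Sum>j\<le>i. \<psi>\<^sup>j \<psi>\<^sup>i\<^sup>-\<^sup>j)\<close> tends to \<open>0\<close> by Mertens' theorem on Cauchy
  products and is uniformly bounded, so its time integral tends to \<open>0\<close>. The
  \<open>\<ell>\<^sup>1\<close>-distance \<open>g\<close> between the periodic solution and the truncation obeys
  \<open>g t \<le> R\<^sub>N + \<integral>\<^sub>t\<^sup>T (4 B + g) g\<close> with \<open>B\<close> a bound for \<open>\<psi>\<^sup>0\<close>; this Gronwall inequality is quadratic, so no a
  priori bound on the periodic solution is needed.\<close>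

section \<open>Differential and integral inequalities integrated backwards from
  \<open>T\<close>\<close>

text \<open>Integrating factor: with \<open>P\<close> an antiderivative of \<open>p\<close>, the
  product \<open>f s * exp (- P s)\<close> has derivative at most 0, so its nonnegative value at
  \<open>T\<close> bounds its earlier values from below.\<close>

lemma backward_comparison_nonneg:
  fixes f f' p :: "real \<Rightarrow> real"
  assumes deriv: "\<And>t. t \<in> {0..T} \<Longrightarrow> (f has_real_derivative f' t) (at t within {0..T})"
    and le: "\<And>t. t \<in> {0..T} \<Longrightarrow> f' t \<le> p t * f t"
    and cont: "continuous_on {0..T} p"
    and final: "f T \<ge> 0"
    and t: "t \<in> {0..T}"
  shows "f t \<ge> 0"
proof -
  define P where "P s = integral {0..s} p" for s
  have P: "(P has_real_derivative p s) (at s within {0..T})" if "s \<in> {0..T}" for s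
    unfolding P_def using integral_has_real_derivative[OF cont that] .
  have D: "((\<lambda>s. f s * exp (- P s)) has_real_derivative (f' s - p s * f s) * exp (- P s))
      (at s within {0..T})" if "s \<in> {0..T}" for s
    by (rule DERIV_cong[OF DERIV_mult[OF deriv[OF that]
            DERIV_chain2[OF DERIV_exp DERIV_minus[OF P[OF that]]]]])
       (simp add: algebra_simps)
  \<comment> \<open>Two-sided derivatives are available only in the interior; continuity covers the
    endpoints.\<close>
  have "f T * exp (- P T) \<le> f t * exp (- P t)"
  proof (rule DERIV_nonpos_imp_decreasing_open[of t T "\<lambda>s. f s * exp (- P s)"])
    show "t \<le> T" using t by simp
    show "\<exists>y. ((\<lambda>s. f s * exp (- P s)) has_real_derivative y) (at x) \<and> y \<le> 0"
      if "t < x" "x < T" for x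
    proof -
      have x: "x \<in> {0..T}" "x \<in> interior {0..T}" using that t by auto
      show ?thesis
        using D[OF x(1)] le[OF x(1)] unfolding at_within_interior[OF x(2)]
        by (intro exI[of _ "(f' x - p x * f x) * exp (- P x)"] conjI mult_nonpos_nonneg) auto
    qed
    have "continuous_on {0..T} (\<lambda>s. f s * exp (- P s))"
      by (rule DERIV_continuous_on[OF D])
    then show "continuous_on {t..T} (\<lambda>s. f s * exp (- P s))"
      by (rule continuous_on_subset) (use t in auto)
  qed
  moreover have "0 \<le> f T * exp (- P T)" using final by simp
  ultimately have "0 \<le> f t * exp (- P t)" by linarith
  then show ?thesis by (simp add: zero_le_mult_iff)
qed

text \<open>The inequality is of logistic type, so it becomes linear for \<open>G / (k + G)\<close>, where \<open>G\<close> is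
  its right-hand side.\<close>

lemma quadratic_backward_gronwall:
  fixes g :: "real \<Rightarrow> real"
  assumes k: "k > 0" and \<rho>: "\<rho> > 0"
    and cont: "continuous_on {0..T} g"
    and nonneg: "\<And>t. t \<in> {0..T} \<Longrightarrow> g t \<ge> 0"
    and bound: "\<And>t. t \<in> {0..T} \<Longrightarrow> g t \<le> \<rho> + integral {t..T} (\<lambda>s. (k + g s) * g s)"
    and t: "t \<in> {0..T}"
  shows "k * g t \<le> \<rho> * exp (k * T) * (k + g t)"
proof -
  define h where "h = (\<lambda>s. (k + g s) * g s)"
  have ch: "continuous_on {0..T} h"
    unfolding h_def by (intro continuous_intros cont)
  have h0: "h s \<ge> 0" if "s \<in> {0..T}" for s using nonneg[OF that] k by (simp add: h_def)
  define G where "G s = \<rho> + integral {s..T} h" for s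
  have Gg: "g s \<le> G s" if "s \<in> {0..T}" for s
    using bound[OF that] by (simp add: G_def h_def)
  have Gpos: "G s > 0" if "s \<in> {0..T}" for s
  proof -
    have "integral {s..T} h \<ge> 0"
      by (rule integral_nonneg)
         (use that h0 in \<open>auto intro!: integrable_continuous_real continuous_on_subset[OF ch]\<close>)
    then show ?thesis using \<rho> by (simp add: G_def)
  qed
  have dG: "(G has_real_derivative - h s) (at s within {0..T})" if "s \<in> {0..T}" for s
  proof -
    \<comment> \<open>The variable lower limit is traded for a variable upper limit by writing the
      integral over \<open>{s..T}\<close> as a difference of integrals starting at 0.\<close>
    have "((\<lambda>s. \<rho> + (integral {0..T} h - integral {0..s} h)) has_real_derivative - h s)
        (at s within {0..T})"
      using DERIV_add[OF DERIV_const DERIV_diff[OF DERIV_const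
            integral_has_real_derivative[OF ch that]]] by simp
    moreover have "\<rho> + (integral {0..T} h - integral {0..u} h) = G u" if "u \<in> {0..T}" for u
      using Henstock_Kurzweil_Integration.integral_combine[of 0 u T h] that
        integrable_continuous_real[OF ch]
      by (auto simp: G_def)
    ultimately show ?thesis
      using that
      by (elim has_field_derivative_transform_within[of _ _ _ _ 1]) auto
  qed
  \<comment> \<open>Put u = \<open>G / (k + G)\<close>. Then u' =
    \<open>- (k * h / (k + G)^2)\<close> is at least -k u. The first term v of \<open>f\<close>
    solves v' = -k v exactly, with v(T) = \<open>\<rho> / k\<close> above u(T) =
    \<open>\<rho> / (k + \<rho>)\<close>. Hence \<open>f\<close> = v - u satisfies f' \<le> -k f and
    is nonnegative at \<open>T\<close>.\<close>
  define f where "f s = exp (k * (T - s)) * \<rho> / k - G s / (k + G s)" for s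
  have "f t \<ge> 0"
  proof (rule backward_comparison_nonneg[where f = f and p = "\<lambda>_. - k"
        and f' = "\<lambda>s. - k * (exp (k * (T - s)) * \<rho> / k) + k * h s / (k + G s)^2"])
    show "(f has_real_derivative - k * (exp (k * (T - s)) * \<rho> / k) + k * h s / (k + G s)^2)
      (at s within {0..T})" if s: "s \<in> {0..T}" for s
    proof -
      have nz: "k + G s \<noteq> 0" using Gpos[OF s] k by simp
      have "- h s * (k + G s) - G s * (0 + - h s) = - (k * h s)"
        by (simp add: algebra_simps)
      then have dG_ratio: "((\<lambda>s. G s / (k + G s)) has_real_derivative - (k * h s / (k + G s)^2))
         (at s within {0..T})"
        using DERIV_divide[OF dG[OF s] DERIV_add[OF DERIV_const dG[OF s]] nz]
        by (simp only: power2_eq_square minus_divide_left)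
      have "((\<lambda>s. exp (k * (T - s)) * \<rho> / k) has_real_derivative
           - k * (exp (k * (T - s)) * \<rho> / k)) (at s within {0..T})"
        using k by (auto intro!: derivative_eq_intros)
      from DERIV_diff[OF this dG_ratio] show ?thesis
        unfolding f_def by simp
    qed
    show "- k * (exp (k * (T - s)) * \<rho> / k) + k * h s / (k + G s)^2 \<le> - k * f s"
      if s: "s \<in> {0..T}" for s
    proof -
      have pos: "k + G s > 0" using Gpos[OF s] k by simp
      have "h s \<le> (k + G s) * G s"
        unfolding h_def using Gg[OF s] nonneg[OF s] k by (intro mult_mono) auto
      then have "h s / (k + G s)^2 \<le> ((k + G s) * G s) / (k + G s)^2"
        by (intro divide_right_mono) auto
      also have "\<dots> = G s / (k + G s)"
        using pos by (simp add: power2_eq_square)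
      finally have "k * (h s / (k + G s)^2) \<le> k * (G s / (k + G s))"
        using k by (intro mult_left_mono) auto
      then show ?thesis by (simp add: f_def algebra_simps)
    qed
    have "\<rho> / (k + \<rho>) \<le> \<rho> / k"
      using k \<rho> by (intro divide_left_mono) auto
    then show "f T \<ge> 0" by (simp add: f_def G_def)
  qed (use t in auto)
  then have "G t / (k + G t) \<le> exp (k * (T - t)) * \<rho> / k" by (simp add: f_def)
  also have "\<dots> \<le> exp (k * T) * \<rho> / k"
    using k \<rho> t by (intro divide_right_mono mult_right_mono) auto
  finally have 1: "G t / (k + G t) \<le> exp (k * T) * \<rho> / k" .
  \<comment> \<open>The map x / (k + x) is increasing for x \<ge> 0, which transfers the bound from
    \<open>G\<close> to \<open>g\<close>.\<close>
  have "g t / (k + g t) \<le> G t / (k + G t)"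
  proof (rule mult_imp_div_pos_le)
    have "g t * (k + G t) \<le> G t * (k + g t)"
      using mult_left_mono[OF Gg[OF t], of k] k by (simp add: algebra_simps)
    then show "g t \<le> G t / (k + G t) * (k + g t)"
      using Gpos[OF t] k by (simp add: pos_le_divide_eq)
  qed (use k nonneg[OF t] in simp)
  with 1 have "g t / (k + g t) \<le> exp (k * T) * \<rho> / k" by linarith
  moreover have "k + g t > 0" using k nonneg[OF t] by simp
  ultimately have "g t \<le> exp (k * T) * \<rho> / k * (k + g t)"
    by (simp only: pos_divide_le_eq)
  \<comment> \<open>The denominator is cleared, but \<open>g t\<close> stays on both sides:
    isolating it requires \<open>\<rho> * exp (k * T) < k\<close>.\<close>
  then have "k * g t \<le> k * (exp (k * T) * \<rho> / k * (k + g t))"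
    using k by (intro mult_left_mono) auto
  then show ?thesis
    using k by (simp add: mult_ac)
qed

section \<open>Cyclic convolution and its wrapped-around terms\<close>

lemma bij_betw_cyclic_diff:
  assumes "j < (N::nat)"
  shows "bij_betw (\<lambda>i. (N + i - j) mod N) {..<N} {..<N}"
proof (rule bij_betwI[where g = "\<lambda>i. (i + j) mod N"])
  show "((N + i - j) mod N + j) mod N = i" if "i \<in> {..<N}" for i
  proof -
    have "N + i - j + j = i + N" using assms by simp
    then show ?thesis using that by (simp add: mod_add_left_eq)
  qed
  show "(N + (i + j) mod N - j) mod N = i" if "i \<in> {..<N}" for i
  proof (cases "i + j < N")
    case False
    moreover have "i + j - N < N" using that assms by simp
    ultimately have "(i + j) mod N = i + j - N" using le_mod_geq[of N "i + j"] by simp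
    then show ?thesis using that assms False by simp
  qed (use that in simp)
qed (use assms in auto)

lemma sum_cyclic_diff:
  assumes "j < (N::nat)"
  shows "(\<Sum>i<N. f ((N + i - j) mod N)) = (\<Sum>i<N. f i)"
  using sum.reindex_bij_betw[OF bij_betw_cyclic_diff[OF assms]] .

text \<open>Convolution on the integers modulo \<open>N\<close>. The summand \<open>N\<close> in the
  index keeps the natural-number subtraction from being cut off at 0.\<close>

definition cyclic_conv :: "nat \<Rightarrow> (nat \<Rightarrow> real) \<Rightarrow> (nat \<Rightarrow> real) \<Rightarrow> nat \<Rightarrow> real" where
  "cyclic_conv N x y i = (\<Sum>j<N. x j * y ((N + i - j) mod N))"

text \<open>For fixed \<open>j\<close> the second index runs through all residues as
  \<open>i\<close> does, so the double sum factors. Applied to absolute values, this makes the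
  \<ell>1-norm submultiplicative.\<close>

lemma sum_cyclic_conv:
  "(\<Sum>i<N. cyclic_conv N x y i) = (\<Sum>i<N. x i) * (\<Sum>i<N. y i)"
proof -
  have "(\<Sum>i<N. cyclic_conv N x y i) = (\<Sum>j<N. \<Sum>i<N. x j * y ((N + i - j) mod N))"
    unfolding cyclic_conv_def by (rule sum.swap)
  also have "\<dots> = (\<Sum>j<N. x j * (\<Sum>i<N. y i))"
    by (intro sum.cong refl) (simp add: sum_distrib_left[symmetric] sum_cyclic_diff)
  finally show ?thesis by (simp add: sum_distrib_right)
qed

lemma abs_cyclic_conv_le: "\<bar>cyclic_conv N x y i\<bar> \<le> cyclic_conv N (\<lambda>j. \<bar>x j\<bar>) (\<lambda>j. \<bar>y j\<bar>) i"
  unfolding cyclic_conv_def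
  by (rule order_trans[OF sum_abs]) (simp add: abs_mult)

lemma sum_abs_cyclic_conv_le:
  "(\<Sum>i<N. \<bar>cyclic_conv N x y i\<bar>) \<le> (\<Sum>i<N. \<bar>x i\<bar>) * (\<Sum>i<N. \<bar>y i\<bar>)"
  unfolding sum_cyclic_conv[symmetric] by (intro sum_mono abs_cyclic_conv_le)

text \<open>Bilinearity in the form aa - bb = (a - b)a + b(a - b); each term of the resulting error
  carries a factor a - b.\<close>

lemma cyclic_conv_diff_squares:
  "cyclic_conv N x x i - cyclic_conv N y y i
    = cyclic_conv N (\<lambda>j. x j - y j) x i + cyclic_conv N y (\<lambda>j. x j - y j) i"
  unfolding cyclic_conv_def
  by (simp add: sum_subtractf[symmetric] sum.distrib[symmetric] algebra_simps)

text \<open>The products whose indices wrap around: those with \<open>j + k = N + i\<close>.\<close>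

definition wrapped_part :: "nat \<Rightarrow> (nat \<Rightarrow> real) \<Rightarrow> nat \<Rightarrow> real" where
  "wrapped_part N x i = (\<Sum>j\<in>{i<..<N}. x j * x (N + i - j))"

text \<open>For \<open>j \<le> i\<close> the index \<open>N + i - j\<close> is at least
  \<open>N\<close> and reduces to \<open>i - j\<close>, giving the Cauchy product; for
  \<open>j > i\<close> it is already below \<open>N\<close>.\<close>

lemma cyclic_conv_eq:
  assumes "i < N"
  shows "cyclic_conv N x x i = (\<Sum>j\<le>i. x j * x (i - j)) + wrapped_part N x i"
proof -
  have "{..<N} = {..i} \<union> {i<..<N}" using assms by auto
  then have "cyclic_conv N x x i = (\<Sum>j\<le>i. x j * x ((N + i - j) mod N))
      + (\<Sum>j\<in>{i<..<N}. x j * x ((N + i - j) mod N))"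
    unfolding cyclic_conv_def by (simp add: sum.union_disjoint ivl_disj_int)
  also have "(\<Sum>j\<le>i. x j * x ((N + i - j) mod N)) = (\<Sum>j\<le>i. x j * x (i - j))"
  proof (intro sum.cong refl)
    fix j assume "j \<in> {..i}"
    then have "N + i - j = (i - j) + N" by simp
    then have "(N + i - j) mod N = i - j" using assms by (simp only: mod_add_self2) simp
    then show "x j * x ((N + i - j) mod N) = x j * x (i - j)" by simp
  qed
  also have "(\<Sum>j\<in>{i<..<N}. x j * x ((N + i - j) mod N)) = wrapped_part N x i"
    unfolding wrapped_part_def by (intro sum.cong refl) auto
  finally show ?thesis .
qed

text \<open>The sum is the square of a partial sum of \<open>x\<close> minus a partial sum of the
  Cauchy square. Absolute summability gives both the same limit,
  \<open>suminf x * suminf x\<close>.\<close>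

lemma tendsto_sum_wrapped_part:
  assumes "summable (\<lambda>i. \<bar>x i\<bar>)"
  shows "(\<lambda>N. \<Sum>i<N. wrapped_part N x i) \<longlonglongrightarrow> 0"
proof -
  have sx: "summable x" using assms by (rule summable_rabs_cancel)
  have "(\<lambda>i. \<Sum>j\<le>i. x j * x (i - j)) sums (suminf x * suminf x)"
    using Cauchy_product_sums[of x x] assms by simp
  then have "(\<lambda>N. (\<Sum>i<N. x i) * (\<Sum>i<N. x i) - (\<Sum>i<N. \<Sum>j\<le>i. x j * x (i - j)))
      \<longlonglongrightarrow> suminf x * suminf x - suminf x * suminf x"
    using summable_LIMSEQ[OF sx] unfolding sums_def by (intro tendsto_intros)
  moreover have "(\<Sum>i<N. wrapped_part N x i)
      = (\<Sum>i<N. x i) * (\<Sum>i<N. x i) - (\<Sum>i<N. \<Sum>j\<le>i. x j * x (i - j))" for N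
    unfolding sum_cyclic_conv[symmetric] sum_subtractf[symmetric]
    by (intro sum.cong refl) (simp add: cyclic_conv_eq)
  ultimately show ?thesis by simp
qed

section \<open>Signs and summability of the infinite solution\<close>

context
  fixes T \<epsilon> c :: real and \<psi> :: "nat \<Rightarrow> real \<Rightarrow> real"
  assumes \<epsilon>: "\<epsilon> > 0" and c: "c > 0"
    and sol: "infinite_riccati_solution T \<epsilon> c \<psi>"
begin

lemma infinite_riccati_deriv:
  "t \<in> {0..T} \<Longrightarrow> (\<psi> i has_real_derivative
     (\<Sum>j\<le>i. \<psi> j t * \<psi> (i - j) t) - riccati_data \<epsilon> i) (at t within {0..T})"
  using sol by (simp add: infinite_riccati_solution_def atLeast0AtMost)

lemma infinite_riccati_final: "\<psi> i T = riccati_data c i"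
  using sol by (simp add: infinite_riccati_solution_def)

lemma infinite_riccati_continuous: "continuous_on {0..T} (\<psi> i)"
  by (rule DERIV_continuous_on[OF infinite_riccati_deriv])

text \<open>The equation for index 0 gives a derivative at most
  \<open>\<psi> 0 t * \<psi> 0 t\<close>, a linear inequality whose coefficient is
  \<open>\<psi> 0\<close> itself.\<close>

lemma infinite_riccati_0_nonneg:
  assumes "t \<in> {0..T}"
  shows "\<psi> 0 t \<ge> 0"
  by (rule backward_comparison_nonneg[OF infinite_riccati_deriv[where i = 0] _
        infinite_riccati_continuous[of 0] _ assms])
     (use \<epsilon> c in \<open>auto simp: infinite_riccati_final riccati_data_def\<close>)

text \<open>In the equation for index n + 1, the two extreme products give a linear term with
  coefficient \<open>2 * \<psi> 0\<close>. The inner products have two nonpositive factors by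
  induction, and the inhomogeneity has the favourable sign.\<close>

lemma infinite_riccati_Suc_nonpos:
  assumes "t \<in> {0..T}"
  shows "\<psi> (Suc n) t \<le> 0"
  using assms
proof (induction n arbitrary: t rule: less_induct)
  case (less n)
  have neg: "\<psi> j s \<le> 0" if "s \<in> {0..T}" "0 < j" "j \<le> n" for j s
    using less.IH[of "j - 1" s] that by simp
  have "0 \<le> - \<psi> (Suc n) t"
  proof (rule backward_comparison_nonneg[OF DERIV_minus[OF infinite_riccati_deriv] _ _ _ less.prems])
    show "- ((\<Sum>j\<le>Suc n. \<psi> j s * \<psi> (Suc n - j) s) - riccati_data \<epsilon> (Suc n))
        \<le> (2 * \<psi> 0 s) * (- \<psi> (Suc n) s)" if s: "s \<in> {0..T}" for s
    proof -
      have "(\<Sum>j\<le>Suc n. \<psi> j s * \<psi> (Suc n - j) s)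
          = 2 * \<psi> 0 s * \<psi> (Suc n) s + (\<Sum>j\<in>{0<..n}. \<psi> j s * \<psi> (Suc n - j) s)"
      proof -
        have "{..Suc n} = insert 0 (insert (Suc n) {0<..n})" by auto
        then show ?thesis by simp
      qed
      moreover have "(\<Sum>j\<in>{0<..n}. \<psi> j s * \<psi> (Suc n - j) s) \<ge> 0"
        using neg s by (intro sum_nonneg mult_nonpos_nonpos) auto
      moreover have "riccati_data \<epsilon> (Suc n) \<le> 0"
        using \<epsilon> by (simp add: riccati_data_def)
      ultimately show ?thesis by linarith
    qed
    show "continuous_on {0..T} (\<lambda>s. 2 * \<psi> 0 s)"
      by (intro continuous_intros infinite_riccati_continuous)
    show "0 \<le> - \<psi> (Suc n) T"
      using c by (simp add: infinite_riccati_final riccati_data_def)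
  qed
  then show ?case by simp
qed

lemma sum_riccati_data: "(\<Sum>i\<le>n. riccati_data x i) = (if n = 0 then x else 0)"
  by (induction n) (auto simp: riccati_data_def)

text \<open>For n \<ge> 1 the inhomogeneities up to n add up to zero, as do the terminal values.
  Grouped by first index, the products become \<open>\<psi> j\<close> times the partial sum up to n
  - j: the term j = 0 is linear in the sum under study, and the others are nonpositive by induction
  and the sign of \<open>\<psi> j\<close>.\<close>

lemma infinite_riccati_partial_sum_nonneg:
  assumes "t \<in> {0..T}"
  shows "(\<Sum>i\<le>n. \<psi> i t) \<ge> 0"
  using assms
proof (induction n arbitrary: t rule: less_induct)
  case (less n)
  show ?case
  proof (cases "n = 0")
    case True
    then show ?thesis using infinite_riccati_0_nonneg less.prems by simp
  next
    case False
    show ?thesis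
    proof (rule backward_comparison_nonneg[OF DERIV_sum _ infinite_riccati_continuous[of 0] _
          less.prems])
      show "(\<psi> i has_real_derivative (\<Sum>j\<le>i. \<psi> j s * \<psi> (i - j) s) - riccati_data \<epsilon> i)
        (at s within {0..T})" if "s \<in> {0..T}" for s i
        using infinite_riccati_deriv[OF that] .
      show "(\<Sum>i\<le>n. (\<Sum>j\<le>i. \<psi> j s * \<psi> (i - j) s) - riccati_data \<epsilon> i)
         \<le> \<psi> 0 s * (\<Sum>i\<le>n. \<psi> i s)" if s: "s \<in> {0..T}" for s
      proof -
        have "(\<Sum>i\<le>n. (\<Sum>j\<le>i. \<psi> j s * \<psi> (i - j) s) - riccati_data \<epsilon> i)
            = (\<Sum>i\<le>n. \<Sum>j\<le>i. \<psi> j s * \<psi> (i - j) s)"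
          using False by (simp add: sum_subtractf sum_riccati_data)
        \<comment> \<open>Both sides run over the triangle j + i \<le> n, first by diagonals and
          then by rows.\<close>
        also have "\<dots> = (\<Sum>j\<le>n. \<Sum>i\<le>n - j. \<psi> j s * \<psi> i s)"
        proof -
          have "{(j, i). j + i \<le> n} = (SIGMA j:{..n}. {..n - j})" by auto
          then show ?thesis
            using sum.triangle_reindex_eq[of "\<lambda>j i. \<psi> j s * \<psi> i s" n] by (simp add: sum.Sigma)
        qed
        also have "\<dots> = (\<Sum>j\<le>n. \<psi> j s * (\<Sum>i\<le>n - j. \<psi> i s))"
          by (simp add: sum_distrib_left)
        also have "\<dots> = \<psi> 0 s * (\<Sum>i\<le>n. \<psi> i s)
            + (\<Sum>j\<in>{0<..n}. \<psi> j s * (\<Sum>i\<le>n - j. \<psi> i s))"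
        proof -
          have "{..n} = insert 0 {0<..n}" by auto
          then show ?thesis by simp
        qed
        also have "\<dots> \<le> \<psi> 0 s * (\<Sum>i\<le>n. \<psi> i s)"
        proof -
          have "\<psi> j s \<le> 0" if "j \<in> {0<..n}" for j
            using infinite_riccati_Suc_nonpos[OF s, of "j - 1"] that by simp
          then have "(\<Sum>j\<in>{0<..n}. \<psi> j s * (\<Sum>i\<le>n - j. \<psi> i s)) \<le> 0"
            using less.IH s by (intro sum_nonpos mult_nonpos_nonneg) auto
          then show ?thesis by simp
        qed
        finally show ?thesis .
      qed
      show "0 \<le> (\<Sum>i\<le>n. \<psi> i T)"
        using c by (simp add: infinite_riccati_final sum_riccati_data)
    qed
  qed
qed

text \<open>Only index 0 contributes a nonnegative term, so the absolute values add up to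
  \<open>2 * \<psi> 0 t\<close> minus a partial sum, which is nonnegative.\<close>

lemma infinite_riccati_abs_sum_le:
  assumes "t \<in> {0..T}"
  shows "(\<Sum>i<n. \<bar>\<psi> i t\<bar>) \<le> 2 * \<psi> 0 t"
proof -
  have "(\<Sum>i\<le>n. \<bar>\<psi> i t\<bar>) = 2 * \<psi> 0 t - (\<Sum>i\<le>n. \<psi> i t)"
    using infinite_riccati_0_nonneg[OF assms] infinite_riccati_Suc_nonpos[OF assms]
    by (induction n) auto
  moreover have "(\<Sum>i<n. \<bar>\<psi> i t\<bar>) \<le> (\<Sum>i\<le>n. \<bar>\<psi> i t\<bar>)"
    by (rule sum_mono2) auto
  ultimately show ?thesis
    using infinite_riccati_partial_sum_nonneg[OF assms, of n] by linarith
qed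

lemma infinite_riccati_abs_summable:
  assumes "t \<in> {0..T}"
  shows "summable (\<lambda>i. \<bar>\<psi> i t\<bar>)"
  using infinite_riccati_abs_sum_le[OF assms] by (intro summableI_nonneg_bounded) auto

section \<open>Residual of the truncated infinite solution\<close>

text \<open>Both indices of a wrapped product are at least 1, so both factors are nonpositive. The
  residual therefore equals its own absolute value.\<close>

lemma wrapped_part_nonneg:
  assumes "t \<in> {0..T}"
  shows "wrapped_part N (\<lambda>i. \<psi> i t) i \<ge> 0"
proof -
  have "\<psi> k t \<le> 0" if "k > 0" for k
    using infinite_riccati_Suc_nonpos[OF assms, of "k - 1"] that by simp
  then show ?thesis
    unfolding wrapped_part_def by (intro sum_nonneg mult_nonpos_nonpos) auto
qed

text \<open>The wrapped products are among the terms of the cyclic convolution of absolute values,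
  whose total is the squared \<ell>1-norm of the truncation. The bound is uniform in
  \<open>N\<close>, as dominated convergence requires.\<close>

lemma sum_wrapped_part_le:
  assumes "t \<in> {0..T}"
  shows "(\<Sum>i<N. wrapped_part N (\<lambda>i. \<psi> i t) i) \<le> (2 * \<psi> 0 t)\<^sup>2"
proof -
  let ?x = "\<lambda>i. \<bar>\<psi> i t\<bar>"
  have "wrapped_part N (\<lambda>i. \<psi> i t) i \<le> cyclic_conv N ?x ?x i" if "i < N" for i
  proof -
    have "wrapped_part N (\<lambda>i. \<psi> i t) i \<le> wrapped_part N ?x i"
      unfolding wrapped_part_def by (intro sum_mono) (metis abs_ge_self abs_mult)
    also have "\<dots> \<le> cyclic_conv N ?x ?x i"
      using that by (simp add: cyclic_conv_eq sum_nonneg)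
    finally show ?thesis .
  qed
  then have "(\<Sum>i<N. wrapped_part N (\<lambda>i. \<psi> i t) i) \<le> (\<Sum>i<N. cyclic_conv N ?x ?x i)"
    by (intro sum_mono) auto
  also have "\<dots> \<le> (2 * \<psi> 0 t) * (2 * \<psi> 0 t)"
    unfolding sum_cyclic_conv using infinite_riccati_abs_sum_le[OF assms]
    by (intro mult_mono) (auto simp: sum_nonneg infinite_riccati_0_nonneg[OF assms])
  finally show ?thesis by (simp add: power2_eq_square)
qed

lemma wrapped_part_continuous:
  "continuous_on {0..T} (\<lambda>t. wrapped_part N (\<lambda>i. \<psi> i t) i)"
  unfolding wrapped_part_def by (intro continuous_intros infinite_riccati_continuous)

lemma infinite_riccati_0_bounded:
  obtains B where "B > 0" "\<And>t. t \<in> {0..T} \<Longrightarrow> \<psi> 0 t \<le> B"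
proof -
  have "bounded (\<psi> 0 ` {0..T})"
    by (intro compact_imp_bounded compact_continuous_image infinite_riccati_continuous) auto
  then obtain B where "B > 0" "\<forall>x\<in>\<psi> 0 ` {0..T}. norm x \<le> B"
    by (auto simp: bounded_pos)
  then show ?thesis by (intro that[of B]) (auto simp: abs_le_iff)
qed

lemma tendsto_integral_wrapped_part:
  "(\<lambda>N. integral {0..T} (\<lambda>t. \<Sum>i<N. wrapped_part N (\<lambda>i. \<psi> i t) i)) \<longlonglongrightarrow> 0"
proof -
  obtain B where B: "B > 0" "\<And>t. t \<in> {0..T} \<Longrightarrow> \<psi> 0 t \<le> B"
    using infinite_riccati_0_bounded by blast
  have "(\<lambda>N. integral {0..T} (\<lambda>t. \<Sum>i<N. wrapped_part N (\<lambda>i. \<psi> i t) i))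
      \<longlonglongrightarrow> integral {0..T} (\<lambda>t. 0)"
  proof (rule dominated_convergence(2)[where h = "\<lambda>_. (2 * B)\<^sup>2"])
    show "(\<lambda>t. \<Sum>i<N. wrapped_part N (\<lambda>i. \<psi> i t) i) integrable_on {0..T}" for N
      by (intro integrable_continuous_real continuous_intros wrapped_part_continuous)
    show "norm (\<Sum>i<N. wrapped_part N (\<lambda>i. \<psi> i t) i) \<le> (2 * B)\<^sup>2" if t: "t \<in> {0..T}" for N t
    proof -
      have "(2 * \<psi> 0 t)\<^sup>2 \<le> (2 * B)\<^sup>2"
        using B(2)[OF t] infinite_riccati_0_nonneg[OF t] by (intro power_mono) auto
      then show ?thesis
        using sum_wrapped_part_le[OF t, of N] wrapped_part_nonneg[OF t]
        by (simp add: sum_nonneg)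
    qed
    show "(\<lambda>N. \<Sum>i<N. wrapped_part N (\<lambda>i. \<psi> i t) i) \<longlonglongrightarrow> 0" if "t \<in> {0..T}" for t
      by (rule tendsto_sum_wrapped_part[OF infinite_riccati_abs_summable[OF that]])
  qed auto
  then show ?thesis by simp
qed

end

section \<open>Error between the periodic and the truncated infinite solution\<close>

text \<open>Periodicity replaces every integer index by its residue in 0, ..., N - 1; a shift by
  \<open>N\<close> is needed exactly when \<open>j \<le> i\<close>.\<close>

lemma periodic_riccati_deriv:
  assumes sol: "periodic_riccati_solution N T \<epsilon> c \<phi>" and "i < N" and t: "t \<in> {0..T}"
  shows "(\<phi> (int i) has_real_derivative
     cyclic_conv N (\<lambda>j. \<phi> (int j) t) (\<lambda>j. \<phi> (int j) t) i - riccati_data \<epsilon> i) (at t within {0..T})"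
proof -
  have per: "\<phi> (k + int N) t = \<phi> k t" for k
    using sol t by (simp add: periodic_riccati_solution_def)
  have "\<phi> (int N + int i - int j) t = \<phi> (int ((N + i - j) mod N)) t" if "j < N" for j
  proof (cases "j \<le> i")
    case True
    then have "N + i - j = (i - j) + N" by simp
    then have "(N + i - j) mod N = i - j" using \<open>i < N\<close> by (simp only: mod_add_self2) simp
    then show ?thesis
      using per[of "int i - int j"] True by (simp add: of_nat_diff algebra_simps)
  next
    case False
    then show ?thesis using that by (simp add: of_nat_diff)
  qed
  moreover have "{0..N-1} = {..<N}" using \<open>i < N\<close> by auto
  ultimately have "cyclic_conv N (\<lambda>j. \<phi> (int j) t) (\<lambda>j. \<phi> (int j) t) i
      = (\<Sum>j=0..N-1. \<phi> (int j) t * \<phi> (int N + int i - int j) t)"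
    unfolding cyclic_conv_def by (intro sum.cong) auto
  then show ?thesis
    using sol \<open>i < N\<close> t by (simp add: periodic_riccati_solution_def)
qed

lemma abs_le_integral_of_derivative:
  fixes f f' :: "real \<Rightarrow> real"
  assumes deriv: "\<And>s. s \<in> {t..T} \<Longrightarrow> (f has_real_derivative f' s) (at s within {t..T})"
    and cont: "continuous_on {t..T} f'" and "f T = 0" and "t \<le> T"
  shows "\<bar>f t\<bar> \<le> integral {t..T} (\<lambda>s. \<bar>f' s\<bar>)"
proof -
  have "(f' has_integral (f T - f t)) {t..T}"
    using deriv \<open>t \<le> T\<close>
    by (intro fundamental_theorem_of_calculus)
       (auto simp flip: has_real_derivative_iff_has_vector_derivative)
  then have "integral {t..T} f' = - f t" using \<open>f T = 0\<close> by (simp add: integral_unique)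
  moreover have "norm (integral {t..T} f') \<le> integral {t..T} (\<lambda>s. \<bar>f' s\<bar>)"
    using cont
    by (intro integral_norm_bound_integral integrable_continuous_real continuous_intros) auto
  ultimately show ?thesis by simp
qed

text \<open>The terminal data agree, so the error is controlled by the integral of its derivative.
  That derivative consists of two convolutions with the error and the wrapped residual.\<close>

lemma riccati_error_integral_bound:
  assumes \<epsilon>: "\<epsilon> > 0" and c: "c > 0"
    and psol: "periodic_riccati_solution N T \<epsilon> c \<phi>"
    and isol: "infinite_riccati_solution T \<epsilon> c \<psi>"
    and B: "\<And>s. s \<in> {0..T} \<Longrightarrow> \<psi> 0 s \<le> B"
    and t: "t \<in> {0..T}"
    and g: "\<And>s. g s = (\<Sum>i<N. \<bar>\<phi> (int i) s - \<psi> i s\<bar>)"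
  shows "g t \<le> integral {0..T} (\<lambda>s. \<Sum>i<N. wrapped_part N (\<lambda>i. \<psi> i s) i)
      + integral {t..T} (\<lambda>s. (4 * B + g s) * g s)"
proof -
  note inf_facts = \<epsilon> c isol
  \<comment> \<open>The inhomogeneities cancel in the difference of the two equations.\<close>
  define e' where "e' i s = cyclic_conv N (\<lambda>j. \<phi> (int j) s) (\<lambda>j. \<phi> (int j) s) i
      - (\<Sum>j\<le>i. \<psi> j s * \<psi> (i - j) s)" for i s
  define r where "r = (\<lambda>s. \<Sum>i<N. wrapped_part N (\<lambda>i. \<psi> i s) i)"
  have sub: "{t..T} \<subseteq> {0..T}" using t by auto
  have de: "((\<lambda>s. \<phi> (int i) s - \<psi> i s) has_real_derivative e' i s) (at s within {0..T})"
    if "i < N" "s \<in> {0..T}" for i s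
    using DERIV_diff[OF periodic_riccati_deriv[OF psol that]
        infinite_riccati_deriv[OF inf_facts that(2), of i]]
    by (simp add: e'_def)
  have c\<phi>: "continuous_on {0..T} (\<phi> (int i))" if "i < N" for i
    by (rule DERIV_continuous_on[OF periodic_riccati_deriv[OF psol that]])
  note c\<psi> = infinite_riccati_continuous[OF inf_facts]
  have ce: "continuous_on {0..T} (e' i)" for i
    unfolding e'_def cyclic_conv_def by (intro continuous_intros c\<phi> c\<psi>) auto
  have cg: "continuous_on {0..T} g"
    unfolding g by (intro continuous_intros c\<phi> c\<psi>) auto
  have cr: "continuous_on {0..T} r"
    unfolding r_def by (intro continuous_intros wrapped_part_continuous[OF inf_facts])
  have r0: "r s \<ge> 0" if "s \<in> {0..T}" for s
    unfolding r_def by (intro sum_nonneg wrapped_part_nonneg[OF inf_facts that])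
  have e_bound: "(\<Sum>i<N. \<bar>e' i s\<bar>) \<le> (4 * B + g s) * g s + r s" if s: "s \<in> {0..T}" for s
  proof -
    let ?a = "\<lambda>j. \<phi> (int j) s" and ?p = "\<lambda>j. \<psi> j s"
    let ?e = "\<lambda>j. ?a j - ?p j"
    have "\<bar>e' i s\<bar> \<le> \<bar>cyclic_conv N ?e ?a i\<bar> + \<bar>cyclic_conv N ?p ?e i\<bar> + wrapped_part N ?p i"
      if "i < N" for i
    proof -
      have "e' i s = cyclic_conv N ?e ?a i + cyclic_conv N ?p ?e i + wrapped_part N ?p i"
        using cyclic_conv_diff_squares[of N ?a i ?p] cyclic_conv_eq[OF that, of ?p]
        unfolding e'_def by linarith
      then show ?thesis
        using wrapped_part_nonneg[OF inf_facts s, of N i] by linarith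
    qed
    then have "(\<Sum>i<N. \<bar>e' i s\<bar>) \<le>
        (\<Sum>i<N. \<bar>cyclic_conv N ?e ?a i\<bar> + \<bar>cyclic_conv N ?p ?e i\<bar> + wrapped_part N ?p i)"
      by (intro sum_mono) auto
    also have "\<dots> = (\<Sum>i<N. \<bar>cyclic_conv N ?e ?a i\<bar>) + (\<Sum>i<N. \<bar>cyclic_conv N ?p ?e i\<bar>) + r s"
      by (simp add: sum.distrib r_def)
    also have "\<dots> \<le> g s * (\<Sum>i<N. \<bar>?a i\<bar>) + (\<Sum>i<N. \<bar>?p i\<bar>) * g s + r s"
      unfolding g by (intro add_mono sum_abs_cyclic_conv_le order_refl)
    also have "\<dots> \<le> g s * (2 * B + g s) + 2 * B * g s + r s"
    proof -
      have g0: "g s \<ge> 0" unfolding g by (intro sum_nonneg) auto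
      have p: "(\<Sum>i<N. \<bar>?p i\<bar>) \<le> 2 * B"
        using infinite_riccati_abs_sum_le[OF inf_facts s, of N] B[OF s] by linarith
      \<comment> \<open>The norm of the periodic solution is estimated through the error itself;
        this produces the term quadratic in \<open>g\<close>.\<close>
      have "(\<Sum>i<N. \<bar>?a i\<bar>) \<le> (\<Sum>i<N. \<bar>?p i\<bar> + \<bar>?e i\<bar>)"
        by (intro sum_mono) auto
      then have "(\<Sum>i<N. \<bar>?a i\<bar>) \<le> 2 * B + g s"
        using p by (simp add: sum.distrib g)
      with p g0 show ?thesis
        by (intro add_mono mult_left_mono mult_right_mono order_refl) auto
    qed
    finally show ?thesis by (simp add: algebra_simps)
  qed
  have integrable: "h integrable_on {t..T}" if "continuous_on {0..T} h" for h :: "real \<Rightarrow> real"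
    using integrable_continuous_real continuous_on_subset[OF that sub] by blast
  have "g t \<le> (\<Sum>i<N. integral {t..T} (\<lambda>s. \<bar>e' i s\<bar>))"
    unfolding g
  proof (intro sum_mono abs_le_integral_of_derivative)
    fix i assume i: "i \<in> {..<N}"
    show "((\<lambda>s. \<phi> (int i) s - \<psi> i s) has_real_derivative e' i s) (at s within {t..T})"
      if "s \<in> {t..T}" for s
      using has_field_derivative_subset[OF de sub] i that sub by auto
    show "continuous_on {t..T} (e' i)" by (rule continuous_on_subset[OF ce sub])
    show "\<phi> (int i) T - \<psi> i T = 0"
      using psol i infinite_riccati_final[OF inf_facts]
      by (simp add: periodic_riccati_solution_def)
    show "t \<le> T" using t by simp
  qed
  also have "\<dots> = integral {t..T} (\<lambda>s. \<Sum>i<N. \<bar>e' i s\<bar>)"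
    by (rule integral_sum[symmetric]) (auto intro!: integrable continuous_intros ce)
  also have "\<dots> \<le> integral {t..T} (\<lambda>s. (4 * B + g s) * g s + r s)"
    using e_bound sub by (intro integral_le integrable continuous_intros ce cg cr) auto
  also have "\<dots> = integral {t..T} (\<lambda>s. (4 * B + g s) * g s) + integral {t..T} r"
    by (intro Henstock_Kurzweil_Integration.integral_add integrable continuous_intros cg cr)
  \<comment> \<open>Since \<open>r\<close> is nonnegative, enlarging the interval makes the residual
    constant independent of \<open>t\<close>, as the Gronwall lemma requires.\<close>
  also have "integral {t..T} r \<le> integral {0..T} r"
    using integral_subset_le[OF sub integrable[OF cr] integrable_continuous_real[OF cr]] r0
    by blast
  finally show ?thesis by (simp add: r_def)
qed

section \<open>Passage to the limit\<close>

theorem proposition1: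
  fixes T \<epsilon> c t :: real and j :: nat
    and \<phi> :: "nat \<Rightarrow> int \<Rightarrow> real \<Rightarrow> real"
    and \<psi> :: "nat \<Rightarrow> real \<Rightarrow> real"
  assumes "T > 0" and "\<epsilon> > 0" and "c > 0"
    and "\<And>N. N \<ge> 2 \<Longrightarrow> periodic_riccati_solution N T \<epsilon> c (\<phi> N)"
    and "infinite_riccati_solution T \<epsilon> c \<psi>"
    and "t \<in> {0..T}"
  shows "(\<lambda>N. \<phi> N (int j) t) \<longlonglongrightarrow> \<psi> j t"
proof -
  note inf_facts = assms(2,3,5)
  obtain B where B: "B > 0" "\<And>s. s \<in> {0..T} \<Longrightarrow> \<psi> 0 s \<le> B"
    using infinite_riccati_0_bounded[OF inf_facts] by blast
  define k where "k = 4 * B"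
  have k: "k > 0" using B by (simp add: k_def)
  define g where "g N s = (\<Sum>i<N. \<bar>\<phi> N (int i) s - \<psi> i s\<bar>)" for N s
  define R where "R N = integral {0..T} (\<lambda>s. \<Sum>i<N. wrapped_part N (\<lambda>i. \<psi> i s) i)" for N
  \<comment> \<open>\<open>R N\<close> is only known to be nonnegative; adding
    \<open>inverse (real N)\<close> gives the strictly positive constant that the Gronwall lemma
    demands, and still tends to 0.\<close>
  define q where "q N = (R N + inverse (real N)) * exp (k * T)" for N
  have R0: "R N \<ge> 0" for N
    unfolding R_def
    by (intro integral_nonneg integrable_continuous_real continuous_intros
        wrapped_part_continuous[OF inf_facts] sum_nonneg wrapped_part_nonneg[OF inf_facts])
  have "R \<longlonglongrightarrow> 0"
    unfolding R_def by (rule tendsto_integral_wrapped_part[OF inf_facts])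
  then have "q \<longlonglongrightarrow> (0 + 0) * exp (k * T)"
    unfolding q_def by (intro tendsto_intros lim_inverse_n)
  then have q: "q \<longlonglongrightarrow> 0" by simp
  have main: "k * g N t \<le> q N * (k + g N t)" if N: "N \<ge> 2" for N
    unfolding q_def
  proof (rule quadratic_backward_gronwall[OF k _ _ _ _ assms(6)])
    show "0 < R N + inverse (real N)"
      using R0[of N] N by (simp add: add_nonneg_pos)
    show "continuous_on {0..T} (g N)"
    proof -
      have "continuous_on {0..T} (\<phi> N (int i))" if "i < N" for i
        by (rule DERIV_continuous_on[OF periodic_riccati_deriv[OF assms(4)[OF N] that]])
      then show ?thesis
        unfolding g_def by (intro continuous_intros infinite_riccati_continuous[OF inf_facts]) auto
    qed
    show "0 \<le> g N s" for s
      unfolding g_def by (intro sum_nonneg) auto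
    show "g N s \<le> R N + inverse (real N) + integral {s..T} (\<lambda>s. (k + g N s) * g N s)"
      if "s \<in> {0..T}" for s
    proof -
      have "g N s \<le> R N + integral {s..T} (\<lambda>s. (k + g N s) * g N s)"
        unfolding R_def k_def
        by (rule riccati_error_integral_bound[OF assms(2,3) assms(4)[OF N] assms(5) B(2) that])
           (simp_all add: g_def)
      moreover have "0 \<le> inverse (real N)" by simp
      ultimately show ?thesis by linarith
    qed
  qed
  \<comment> \<open>Below \<open>k / 2\<close> the term \<open>q N * g N t\<close> is absorbed into
    half of the left-hand side of \<open>main\<close>, leaving
    \<open>g N t \<le> 2 * q N\<close>.\<close>
  have "eventually (\<lambda>N. q N < k / 2) sequentially"
    using order_tendstoD(2)[OF q, of "k / 2"] k by simp
  then have "eventually (\<lambda>N. norm (\<phi> N (int j) t - \<psi> j t) \<le> 2 * q N) sequentially"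
    \<comment> \<open>The bound 2 makes the periodic system available; \<open>Suc j\<close> ensures
      j < N, so that index \<open>j\<close> occurs in the sum \<open>g N t\<close>.\<close>
    using eventually_ge_at_top[of "max 2 (Suc j)"]
  proof eventually_elim
    case (elim N)
    have g0: "g N t \<ge> 0" unfolding g_def by (intro sum_nonneg) auto
    have "q N * g N t \<le> k / 2 * g N t"
      using elim g0 by (intro mult_right_mono) auto
    moreover have "k * g N t \<le> q N * (k + g N t)"
      using main elim by simp
    ultimately have "k * g N t \<le> k * (2 * q N)"
      by (simp add: algebra_simps)
    then have "g N t \<le> 2 * q N"
      using k by simp
    moreover have "\<bar>\<phi> N (int j) t - \<psi> j t\<bar> \<le> g N t"
      unfolding g_def by (rule member_le_sum) (use elim in auto)
    ultimately show ?case by simp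
  qed
  then have "(\<lambda>N. \<phi> N (int j) t - \<psi> j t) \<longlonglongrightarrow> 0"
    by (rule Lim_null_comparison) (use tendsto_mult_left[OF q, of 2] in simp)
  then show ?thesis by (rule LIM_zero_cancel)
qed

end
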